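(* Let $\mathbf{B}=(\{0,1\},+,\cdot,0,1)$ be the Boolean semiring and let $M$ be a $\mathbf{B}$-semimodule. Then the following conditions are equivalent: (i) $M$ is minimal; (ii) $M$ is elementary; (iii) $M$ is simple; (iv) $M$ is isomorphic to the left regular semimodule ${}_{\mathbf{B}}\mathbf{B}$.
   Context: A semiring is a tuple $(R,+,\cdot,0,1)$ where $(R,+,0)$ is a commutative monoid, $(R,\cdot,1)$ is a monoid, multiplication distributes over addition on both sides, and $0a=a0=0$ for all $a\in R$. A (left) $R$-semimodule is a commutative monoid $(M,+,0_M)$ with a map $R\times M\to M$, $(r,m)\mapsto r(m)$, such that $r(m+n)=r(m)+r(n)$, $r(0_M)=0_M$, $(r+s)(m)=r(m)+s(m)$, $(rs)(m)=r(s(m))$, $0(m)=0_M$, $1(m)=m$. Homomorphisms of semimodules are monoid homomorphisms commuting with the action of $R$. A subsemimodule is a submonoid closed under the action of $R$. An $R$-congruence on $M$ is an equivalence relation $\sim$ such that $m\sim n$ implies $m+k\sim n+k$ for all $k\in M$ and $r(m)\sim r(n)$ for all $r\in R$. A non-zero $R$-semimodule $M$ is called minimal if its only subsemimodules are $\{0_M\}$ and $M$; elementary if its only $R$-congruences are the equality relation and the full relation $M\times M$; simple if it is both minimal and elementary. In $\mathbf{B}$ one has $1+1=1$ (and otherwise the usual addition and multiplication of $0$ and $1$). The left regular semimodule ${}_{\mathbf{B}}\mathbf{B}$ is the additive monoid of $\mathbf{B}$ with $\mathbf{B}$ acting by left multiplication. *)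

theory Defs
  imports "HOL-Algebra.Module"
begin

text \<open>
  Semimodules are carried by the record type of modules from \<open>HOL-Algebra\<close>; as for
  modules there, the fields \<open>mult\<close> and \<open>one\<close> of \<open>M\<close> are irrelevant.
\<close>

locale semimodule = R?: semiring R + M?: abelian_monoid M
  for R :: "('a, 'r) ring_scheme" (structure) and M :: "('a, 'm, 'c) module_scheme" (structure) +
  assumes smult_closed:
      "\<lbrakk>r \<in> carrier R; m \<in> carrier M\<rbrakk> \<Longrightarrow> r \<odot>\<^bsub>M\<^esub> m \<in> carrier M"
    and smult_r_distr:
      "\<lbrakk>r \<in> carrier R; m \<in> carrier M; n \<in> carrier M\<rbrakk> \<Longrightarrow>
        r \<odot>\<^bsub>M\<^esub> (m \<oplus>\<^bsub>M\<^esub> n) = r \<odot>\<^bsub>M\<^esub> m \<oplus>\<^bsub>M\<^esub> r \<odot>\<^bsub>M\<^esub> n"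
    and smult_r_null:
      "r \<in> carrier R \<Longrightarrow> r \<odot>\<^bsub>M\<^esub> \<zero>\<^bsub>M\<^esub> = \<zero>\<^bsub>M\<^esub>"
    and smult_l_distr:
      "\<lbrakk>r \<in> carrier R; s \<in> carrier R; m \<in> carrier M\<rbrakk> \<Longrightarrow>
        (r \<oplus>\<^bsub>R\<^esub> s) \<odot>\<^bsub>M\<^esub> m = r \<odot>\<^bsub>M\<^esub> m \<oplus>\<^bsub>M\<^esub> s \<odot>\<^bsub>M\<^esub> m"
    and smult_assoc:
      "\<lbrakk>r \<in> carrier R; s \<in> carrier R; m \<in> carrier M\<rbrakk> \<Longrightarrow>
        (r \<otimes>\<^bsub>R\<^esub> s) \<odot>\<^bsub>M\<^esub> m = r \<odot>\<^bsub>M\<^esub> (s \<odot>\<^bsub>M\<^esub> m)"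
    and smult_l_null:
      "m \<in> carrier M \<Longrightarrow> \<zero>\<^bsub>R\<^esub> \<odot>\<^bsub>M\<^esub> m = \<zero>\<^bsub>M\<^esub>"
    and smult_one:
      "m \<in> carrier M \<Longrightarrow> \<one>\<^bsub>R\<^esub> \<odot>\<^bsub>M\<^esub> m = m"

definition semimodule_hom ::
  "('a, 'r) ring_scheme \<Rightarrow> ('a, 'm, 'c) module_scheme \<Rightarrow> ('a, 'n, 'd) module_scheme \<Rightarrow> ('m \<Rightarrow> 'n) set"
  where "semimodule_hom R M N =
    {f \<in> carrier M \<rightarrow> carrier N.
      (\<forall>m\<in>carrier M. \<forall>n\<in>carrier M. f (m \<oplus>\<^bsub>M\<^esub> n) = f m \<oplus>\<^bsub>N\<^esub> f n) \<and>
      f \<zero>\<^bsub>M\<^esub> = \<zero>\<^bsub>N\<^esub> \<and>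
      (\<forall>r\<in>carrier R. \<forall>m\<in>carrier M. f (r \<odot>\<^bsub>M\<^esub> m) = r \<odot>\<^bsub>N\<^esub> f m)}"

definition semimodule_isomorphic ::
  "('a, 'r) ring_scheme \<Rightarrow> ('a, 'm, 'c) module_scheme \<Rightarrow> ('a, 'n, 'd) module_scheme \<Rightarrow> bool"
  where "semimodule_isomorphic R M N \<longleftrightarrow>
    (\<exists>f \<in> semimodule_hom R M N. bij_betw f (carrier M) (carrier N))"

definition subsemimodule ::
  "'m set \<Rightarrow> ('a, 'r) ring_scheme \<Rightarrow> ('a, 'm, 'c) module_scheme \<Rightarrow> bool"
  where "subsemimodule N R M \<longleftrightarrow>
    submonoid N (add_monoid M) \<and>
    (\<forall>r\<in>carrier R. \<forall>n\<in>N. r \<odot>\<^bsub>M\<^esub> n \<in> N)"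

definition semimodule_congruence ::
  "('m \<times> 'm) set \<Rightarrow> ('a, 'r) ring_scheme \<Rightarrow> ('a, 'm, 'c) module_scheme \<Rightarrow> bool"
  where "semimodule_congruence C R M \<longleftrightarrow>
    equiv (carrier M) C \<and>
    (\<forall>m n. (m, n) \<in> C \<longrightarrow>
      (\<forall>k\<in>carrier M. (m \<oplus>\<^bsub>M\<^esub> k, n \<oplus>\<^bsub>M\<^esub> k) \<in> C) \<and>
      (\<forall>r\<in>carrier R. (r \<odot>\<^bsub>M\<^esub> m, r \<odot>\<^bsub>M\<^esub> n) \<in> C))"

text \<open>All three notions below are reserved for non-zero semimodules.\<close>

definition minimal_semimodule ::
  "('a, 'r) ring_scheme \<Rightarrow> ('a, 'm, 'c) module_scheme \<Rightarrow> bool"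
  where "minimal_semimodule R M \<longleftrightarrow>
    semimodule R M \<and> carrier M \<noteq> {\<zero>\<^bsub>M\<^esub>} \<and>
    (\<forall>N. subsemimodule N R M \<longrightarrow> N = {\<zero>\<^bsub>M\<^esub>} \<or> N = carrier M)"

definition elementary_semimodule ::
  "('a, 'r) ring_scheme \<Rightarrow> ('a, 'm, 'c) module_scheme \<Rightarrow> bool"
  where "elementary_semimodule R M \<longleftrightarrow>
    semimodule R M \<and> carrier M \<noteq> {\<zero>\<^bsub>M\<^esub>} \<and>
    (\<forall>C. semimodule_congruence C R M \<longrightarrow>
      C = Id_on (carrier M) \<or> C = carrier M \<times> carrier M)"

definition simple_semimodule ::
  "('a, 'r) ring_scheme \<Rightarrow> ('a, 'm, 'c) module_scheme \<Rightarrow> bool"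
  where "simple_semimodule R M \<longleftrightarrow> minimal_semimodule R M \<and> elementary_semimodule R M"

definition left_regular_semimodule :: "('a, 'r) ring_scheme \<Rightarrow> ('a, 'a) module"
  where "left_regular_semimodule R =
    \<lparr>carrier = carrier R, mult = mult R, one = one R, zero = zero R, add = add R, smult = mult R\<rparr>"

text \<open>The elements \<open>0\<close> and \<open>1\<close> are \<^const>\<open>False\<close> and \<^const>\<open>True\<close>.\<close>

definition boolean_semiring :: "bool ring"
  where "boolean_semiring =
    \<lparr>carrier = UNIV, mult = (\<and>), one = True, zero = False, add = (\<or>)\<rparr>"

lemma semiring_boolean_semiring: "semiring boolean_semiring"
  by unfold_locales (auto simp: boolean_semiring_def)

lemma (in semiring) semimodule_left_regular:
  "semimodule R (left_regular_semimodule R)"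
  by unfold_locales
    (auto simp: left_regular_semimodule_def add.m_ac m_assoc l_distr r_distr)

end

theory Submission
  imports Defs
begin

text \<open>
  Since \<open>1 + 1 = 1\<close> holds in the Boolean semiring, addition in a semimodule over it is
  idempotent; the scalars \<open>0\<close> and \<open>1\<close> act as the zero map and the identity, so
  everything happens in the additive monoid. All conditions of the theorem turn out to say
  that the semimodule has exactly two elements, \<open>\<zero>\<close> and some \<open>x \<noteq> \<zero>\<close>.

  A minimal semimodule has two elements because idempotence makes every pair \<open>{\<zero>, x}\<close> a
  subsemimodule (\<open>subsemimodule_zero_pair\<close>). An elementary one has two elements because
  idempotence also makes the nonzero elements closed under addition of arbitrary elements, so that
  ``both zero or both nonzero'' is a congruence (\<open>congruence_zero_vs_nonzero\<close>); it separates
  \<open>\<zero>\<close> from the rest, hence must be equality, hence there is just one nonzero element.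
  Conversely, two elements leave no room for further subsemimodules or congruences, over any
  semiring, and idempotence determines the whole structure on \<open>{\<zero>, x}\<close>, which is that of the
  left regular semimodule.
\<close>

lemma boolean_semiring_simps:
  "carrier boolean_semiring = UNIV"
  "\<one>\<^bsub>boolean_semiring\<^esub> = True"
  "\<zero>\<^bsub>boolean_semiring\<^esub> = False"
  "r \<oplus>\<^bsub>boolean_semiring\<^esub> s = (r \<or> s)"
  "r \<otimes>\<^bsub>boolean_semiring\<^esub> s = (r \<and> s)"
  by (simp_all add: boolean_semiring_def)

lemma boolean_smult:
  assumes "semimodule boolean_semiring M" and "m \<in> carrier M"
  shows "r \<odot>\<^bsub>M\<^esub> m = (if r then m else \<zero>\<^bsub>M\<^esub>)"
proof -
  interpret semimodule boolean_semiring M by fact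
  show ?thesis
    using smult_one[OF assms(2)] smult_l_null[OF assms(2)]
    by (cases r) (simp_all add: boolean_semiring_simps)
qed

lemma boolean_add_idem:
  assumes "semimodule boolean_semiring M" and "m \<in> carrier M"
  shows "m \<oplus>\<^bsub>M\<^esub> m = m"
proof -
  interpret semimodule boolean_semiring M by fact
  show ?thesis
    using smult_l_distr[of True True m] assms
    by (simp add: boolean_semiring_simps boolean_smult[OF assms(1)])
qed

text \<open>
  An idempotent commutative monoid is a join semilattice with least element \<open>\<zero>\<close>, and a
  join is least only if both arguments are.
\<close>

lemma boolean_add_eq_zero_iff:
  assumes "semimodule boolean_semiring M" and m: "m \<in> carrier M" and n: "n \<in> carrier M"
  shows "m \<oplus>\<^bsub>M\<^esub> n = \<zero>\<^bsub>M\<^esub> \<longleftrightarrow> m = \<zero>\<^bsub>M\<^esub> \<and> n = \<zero>\<^bsub>M\<^esub>"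
proof
  interpret semimodule boolean_semiring M by fact
  assume zero: "m \<oplus>\<^bsub>M\<^esub> n = \<zero>\<^bsub>M\<^esub>"
  have "m = m \<oplus>\<^bsub>M\<^esub> (m \<oplus>\<^bsub>M\<^esub> n)"
    using zero m by simp
  also have "\<dots> = (m \<oplus>\<^bsub>M\<^esub> m) \<oplus>\<^bsub>M\<^esub> n"
    using m n by (simp add: M.a_assoc)
  also have "\<dots> = \<zero>\<^bsub>M\<^esub>"
    using boolean_add_idem[OF assms(1) m] zero by simp
  finally have "m = \<zero>\<^bsub>M\<^esub>" .
  then show "m = \<zero>\<^bsub>M\<^esub> \<and> n = \<zero>\<^bsub>M\<^esub>"
    using zero n by simp
next
  interpret semimodule boolean_semiring M by fact
  show "m = \<zero>\<^bsub>M\<^esub> \<and> n = \<zero>\<^bsub>M\<^esub> \<Longrightarrow> m \<oplus>\<^bsub>M\<^esub> n = \<zero>\<^bsub>M\<^esub>"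
    by simp
qed

lemma subsemimodule_zero_pair:
  assumes "semimodule boolean_semiring M" and x: "x \<in> carrier M"
  shows "subsemimodule {\<zero>\<^bsub>M\<^esub>, x} boolean_semiring M"
proof -
  interpret semimodule boolean_semiring M by fact
  have "submonoid {\<zero>\<^bsub>M\<^esub>, x} (add_monoid M)"
    by unfold_locales (use x in \<open>auto simp: boolean_add_idem[OF assms]\<close>)
  then show ?thesis
    using x by (auto simp: subsemimodule_def boolean_smult[OF assms(1)])
qed

text \<open>
  This is the kernel congruence of the map to the two-element semimodule that sends each nonzero
  element to \<open>1\<close>; the absence of nontrivial zero sums makes that map additive.
\<close>

lemma congruence_zero_vs_nonzero:
  assumes "semimodule boolean_semiring M"
  shows "semimodule_congruence
    {(m, n). m \<in> carrier M \<and> n \<in> carrier M \<and> (m = \<zero>\<^bsub>M\<^esub> \<longleftrightarrow> n = \<zero>\<^bsub>M\<^esub>)} boolean_semiring M"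
    (is "semimodule_congruence ?C _ _")
proof -
  interpret semimodule boolean_semiring M by fact
  have "equiv (carrier M) ?C"
    by (rule equivI) (auto simp: refl_on_def sym_def trans_def)
  then show ?thesis
    by (auto simp: semimodule_congruence_def boolean_add_eq_zero_iff[OF assms]
        boolean_smult[OF assms])
qed

lemma minimal_imp_two_elements:
  assumes "minimal_semimodule boolean_semiring M"
  obtains x where "x \<noteq> \<zero>\<^bsub>M\<^esub>" and "carrier M = {\<zero>\<^bsub>M\<^esub>, x}"
proof -
  have sm: "semimodule boolean_semiring M"
    using assms by (simp add: minimal_semimodule_def)
  interpret semimodule boolean_semiring M by fact
  obtain x where x: "x \<in> carrier M" "x \<noteq> \<zero>\<^bsub>M\<^esub>"
    using assms M.zero_closed unfolding minimal_semimodule_def by blast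
  have "{\<zero>\<^bsub>M\<^esub>, x} = carrier M"
    using assms subsemimodule_zero_pair[OF sm x(1)] x(2)
    unfolding minimal_semimodule_def by blast
  with x(2) that show thesis by metis
qed

lemma elementary_imp_two_elements:
  assumes "elementary_semimodule boolean_semiring M"
  obtains x where "x \<noteq> \<zero>\<^bsub>M\<^esub>" and "carrier M = {\<zero>\<^bsub>M\<^esub>, x}"
proof -
  have sm: "semimodule boolean_semiring M"
    using assms by (simp add: elementary_semimodule_def)
  interpret semimodule boolean_semiring M by fact
  obtain x where x: "x \<in> carrier M" "x \<noteq> \<zero>\<^bsub>M\<^esub>"
    using assms M.zero_closed unfolding elementary_semimodule_def by blast
  define C where
    "C = {(m, n). m \<in> carrier M \<and> n \<in> carrier M \<and> (m = \<zero>\<^bsub>M\<^esub> \<longleftrightarrow> n = \<zero>\<^bsub>M\<^esub>)}"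
  have "C = Id_on (carrier M) \<or> C = carrier M \<times> carrier M"
    using assms congruence_zero_vs_nonzero[OF sm]
    unfolding elementary_semimodule_def C_def by blast
  moreover have "(\<zero>\<^bsub>M\<^esub>, x) \<notin> C"
    using x by (simp add: C_def)
  ultimately have C: "C = Id_on (carrier M)"
    using x by auto
  have "m = x" if "m \<in> carrier M" "m \<noteq> \<zero>\<^bsub>M\<^esub>" for m
  proof -
    have "(m, x) \<in> C"
      using that x by (simp add: C_def)
    then show ?thesis
      by (simp add: C Id_on_iff)
  qed
  then have "carrier M = {\<zero>\<^bsub>M\<^esub>, x}"
    using x(1) by auto
  with x(2) that show thesis by blast
qed

lemma two_elements_imp_minimal:
  assumes "semimodule R M" and "x \<noteq> \<zero>\<^bsub>M\<^esub>" and "carrier M = {\<zero>\<^bsub>M\<^esub>, x}"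
  shows "minimal_semimodule R M"
proof -
  have "N = {\<zero>\<^bsub>M\<^esub>} \<or> N = carrier M" if "subsemimodule N R M" for N
  proof -
    have "N \<subseteq> carrier M" "\<zero>\<^bsub>M\<^esub> \<in> N"
      using that submonoid.subset[of N "add_monoid M"] submonoid.one_closed[of N "add_monoid M"]
      by (auto simp: subsemimodule_def)
    then show ?thesis
      using assms(3) by auto
  qed
  then show ?thesis
    using assms unfolding minimal_semimodule_def by blast
qed

lemma two_elements_imp_elementary:
  assumes "semimodule R M" and "x \<noteq> \<zero>\<^bsub>M\<^esub>" and "carrier M = {\<zero>\<^bsub>M\<^esub>, x}"
  shows "elementary_semimodule R M"
proof -
  have "C = Id_on (carrier M) \<or> C = carrier M \<times> carrier M"
    if "semimodule_congruence C R M" for C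
  proof -
    have equiv: "equiv (carrier M) C"
      using that by (simp add: semimodule_congruence_def)
    then have sub: "C \<subseteq> carrier M \<times> carrier M"
      by (rule equiv_type)
    have diag: "(m, m) \<in> C" if "m \<in> carrier M" for m
      using equiv that by (meson equivE refl_onD)
    have swap: "(n, m) \<in> C" if "(m, n) \<in> C" for m n
      using equiv that by (meson equivE symD)
    show ?thesis
    proof (cases "(\<zero>\<^bsub>M\<^esub>, x) \<in> C")
      case True
      then show ?thesis
        using sub diag swap assms(3) by auto
    next
      case False
      then have "(x, \<zero>\<^bsub>M\<^esub>) \<notin> C"
        using swap by blast
      with False have "C = Id_on (carrier M)"
        using sub diag assms(3) by (auto simp: Id_on_iff)
      then show ?thesis ..
    qed
  qed
  then show ?thesis
    using assms unfolding elementary_semimodule_def by blast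
qed

lemma two_elements_imp_isomorphic_regular:
  assumes "semimodule boolean_semiring M" and "x \<noteq> \<zero>\<^bsub>M\<^esub>" and "carrier M = {\<zero>\<^bsub>M\<^esub>, x}"
  shows "semimodule_isomorphic boolean_semiring M (left_regular_semimodule boolean_semiring)"
proof -
  let ?f = "\<lambda>m. m \<noteq> \<zero>\<^bsub>M\<^esub>"
  have "?f \<in> semimodule_hom boolean_semiring M (left_regular_semimodule boolean_semiring)"
    by (auto simp: semimodule_hom_def left_regular_semimodule_def boolean_semiring_simps
        boolean_add_eq_zero_iff[OF assms(1)] boolean_smult[OF assms(1)])
  moreover have
    "bij_betw ?f (carrier M) (carrier (left_regular_semimodule boolean_semiring))"
    using assms(2,3)
    by (auto simp: bij_betw_def inj_on_def left_regular_semimodule_def boolean_semiring_simps)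
  ultimately show ?thesis
    unfolding semimodule_isomorphic_def by blast
qed

lemma isomorphic_regular_imp_two_elements:
  assumes "semimodule boolean_semiring M"
    and "semimodule_isomorphic boolean_semiring M (left_regular_semimodule boolean_semiring)"
  obtains x where "x \<noteq> \<zero>\<^bsub>M\<^esub>" and "carrier M = {\<zero>\<^bsub>M\<^esub>, x}"
proof -
  interpret semimodule boolean_semiring M by fact
  obtain f where zero: "\<not> f \<zero>\<^bsub>M\<^esub>" and bij: "bij_betw f (carrier M) UNIV"
    using assms(2)
    by (auto simp: semimodule_isomorphic_def semimodule_hom_def left_regular_semimodule_def
        boolean_semiring_simps)
  obtain x where x: "x \<in> carrier M" "f x"
    using bij_betw_imp_surj_on[OF bij] by (metis UNIV_I imageE)
  have "m = \<zero>\<^bsub>M\<^esub> \<or> m = x" if "m \<in> carrier M" for m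
    using inj_onD[OF bij_betw_imp_inj_on[OF bij]] that x zero M.zero_closed by metis
  then have "carrier M = {\<zero>\<^bsub>M\<^esub>, x}"
    using x(1) by auto
  moreover have "x \<noteq> \<zero>\<^bsub>M\<^esub>"
    using x zero by auto
  ultimately show thesis
    using that by blast
qed

theorem theorem3p2:
  fixes M :: "(bool, 'm, 'c) module_scheme"
  assumes "semimodule boolean_semiring M"
  shows "(minimal_semimodule boolean_semiring M \<longleftrightarrow> elementary_semimodule boolean_semiring M) \<and>
    (elementary_semimodule boolean_semiring M \<longleftrightarrow> simple_semimodule boolean_semiring M) \<and>
    (simple_semimodule boolean_semiring M \<longleftrightarrow>
      semimodule_isomorphic boolean_semiring M (left_regular_semimodule boolean_semiring))"
proof -
  let ?two = "\<exists>x. x \<noteq> \<zero>\<^bsub>M\<^esub> \<and> carrier M = {\<zero>\<^bsub>M\<^esub>, x}"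
  have minimal: "minimal_semimodule boolean_semiring M \<longleftrightarrow> ?two"
    using minimal_imp_two_elements two_elements_imp_minimal[OF assms] by metis
  have elementary: "elementary_semimodule boolean_semiring M \<longleftrightarrow> ?two"
    using elementary_imp_two_elements two_elements_imp_elementary[OF assms] by metis
  have regular: "semimodule_isomorphic boolean_semiring M
      (left_regular_semimodule boolean_semiring) \<longleftrightarrow> ?two"
    using isomorphic_regular_imp_two_elements[OF assms]
      two_elements_imp_isomorphic_regular[OF assms] by metis
  show ?thesis
    unfolding simple_semimodule_def minimal elementary regular by simp
qed

end
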